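(* The scalar linear time invariant system $X_{t+1}=\lambda X_t+BU_t+W_t$ can be mean square stabilized using a linear scheme over the cascade network with $L-1$ half-duplex relay nodes if $$\log(|\lambda|)<\max_{P_r^i:\ \sum_{i=1}^{L-1}P_r^i\le P_R}\ \frac{1}{2L}\log\left(1+\frac{LP_S}{LP_S+N_1}\prod_{i=1}^{L-1}\left(\frac{LP_r^i}{LP_r^i+N_{i+1}}\right)\right),$$ where the optimal power allocation is given by $$P_r^i=\frac{-N_{i+1}+\sqrt{N_{i+1}^2-\frac{4N_{i+1}}{\gamma}}}{2}$$ and $\gamma<0$ is chosen such that $\sum_{i=1}^{L-1}P_r^i\le P_R$. When all $N_i$ are equal, the optimal choice is $P_r^i=\frac{P_R}{L-1}$.
   Context: Notation: $\mathbb N=\{0,1,2,\dots\}$, $X_{[0,t]}=(X_0,\dots,X_t)$, $\log$ is base 2, $h(\cdot)$ is differential entropy. Plant (scalar): $X_{t+1}=\lambda X_t+BU_t+W_t$, $t\in\mathbb N$, $X_t,U_t,W_t\in\mathbb R$, $|\lambda|\ge1$, $(\lambda,B)$ controllable (i.e. $B\neq0$). $X_0$ is a random variable with $|h(X_0)|<\infty$ and given variance; $\{W_t\}$ is a zero-mean white Gaussian sequence of given variance, independent of $X_0$. The system is mean square stabilized if there is a constant $M<\infty$ with $\mathbb E[X_t^2]<M$ for all $t$. Cascade network: a state encoder, relays $\mathcal R_1,\dots,\mathcal R_{L-1}$ in series, and a remote decoder/controller. Only one node transmits in each time step: - the encoder sends $S_{e,t}=f_t(X_{[0,t]},U_{[0,t-1]})$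 for $t=1+nL$, $n\in\mathbb N$, and $S_{e,t}=0$ otherwise; - relay $\mathcal R_i$ sends $S^i_{r,t}=g^i_t(Y^i_{[0,t]})$ for $t=1+i+nL$, $n\in\mathbb N$, and $S^i_{r,t}=0$ otherwise; - $\mathcal R_1$ receives $Y^1_t=S_{e,t}+Z^1_t$ at $t=nL+1$; for $2\le i\le L-1$, $\mathcal R_i$ receives $Y^i_t=S^{i-1}_{r,t}+Z^i_t$ at $t=nL+i$; and $Y^i_t=0$ at all other times; - the controller receives $R_t=S^{L-1}_{r,t}+Z^L_t$ at $t=nL$ and $R_t=0$ otherwise, and applies $U_t=\pi_t(R_{[0,t]})$. The transmitted signals satisfy, at the respective transmission times, $\mathbb E[S_{e,t}^2]=LP_S$ and $\mathbb E[(S^i_{r,t})^2]=LP_r^i$, where the $P_r^i$ (nonnegative powers) satisfy $\sum_{i=1}^{L-1}P_r^i\le P_R$. The noises $Z^i_t\sim\mathcal N(0,N_i)$, $i=1,\dots,L$, are mutually independent, white, and independent of $X_0$ and $\{W_t\}$. A linear scheme is one in which all policies $f_t,g^i_t,\pi_t$ are linear functions of their arguments.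
   Formalization: The printed allocation is not optimal for L≥3 with unequal noises; the formula is divided by L, i.e. P_r^i = (-N_{i+1}+√(N_{i+1}²-4N_{i+1}/γ))/(2L), and γ<0 is chosen so that ΣP_r^i = P_R rather than merely ≤ P_R. *)

theory Defs
  imports "HOL-Probability.Probability"
begin

text \<open>Primitive random variables: initial state, process noise, and the noise
  of channel \<open>i\<close> at time \<open>t\<close>.\<close>

datatype source = Initial | Process nat | Channel nat nat

primrec source_var ::
  "('a \<Rightarrow> real) \<Rightarrow> (nat \<Rightarrow> 'a \<Rightarrow> real) \<Rightarrow> (nat \<Rightarrow> nat \<Rightarrow> 'a \<Rightarrow> real) \<Rightarrow> source \<Rightarrow> 'a \<Rightarrow> real"
where
  "source_var X0 W Z Initial = X0"
| "source_var X0 W Z (Process t) = W t"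
| "source_var X0 W Z (Channel i t) = Z i t"

text \<open>The differential entropy of a real random variable is
  \<open>- (\<integral>x. f x * log 2 (f x) \<partial>lborel)\<close> for a density \<open>f\<close>.  The library's \<open>entropy\<close> is a total
  real-valued function, so finiteness has to be expressed as integrability.\<close>

definition finite_differential_entropy :: "'a measure \<Rightarrow> ('a \<Rightarrow> real) \<Rightarrow> bool" where
  "finite_differential_entropy M X \<longleftrightarrow>
     (\<exists>f :: real \<Rightarrow> real. (\<forall>x. 0 \<le> f x) \<and> distributed M lborel X (\<lambda>x. ennreal (f x)) \<and>
        integrable lborel (\<lambda>x. f x * log 2 (f x)))"

text \<open>\<open>normal_density\<close> takes the standard deviation, whereas \<open>vW\<close> and \<open>N i\<close> are variances.
  The mean of the initial state is unconstrained.  A white Gaussian sequence is a sequence of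
  independent Gaussian variables, so all primitive variables are mutually independent.\<close>

definition cascade_sources ::
  "'a measure \<Rightarrow> nat \<Rightarrow> real \<Rightarrow> (nat \<Rightarrow> real) \<Rightarrow>
   ('a \<Rightarrow> real) \<Rightarrow> (nat \<Rightarrow> 'a \<Rightarrow> real) \<Rightarrow> (nat \<Rightarrow> nat \<Rightarrow> 'a \<Rightarrow> real) \<Rightarrow> bool" where
  "cascade_sources M L vW N X0 W Z \<longleftrightarrow>
     finite_differential_entropy M X0 \<and>
     integrable M (\<lambda>\<omega>. (X0 \<omega>)\<^sup>2) \<and>
     (\<forall>t. distributed M lborel (W t) (\<lambda>x. ennreal (normal_density 0 (sqrt vW) x))) \<and>
     (\<forall>i\<in>{1..L}. \<forall>t.
        distributed M lborel (Z i t) (\<lambda>x. ennreal (normal_density 0 (sqrt (N i)) x))) \<and>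
     prob_space.indep_vars M (\<lambda>_. borel) (source_var X0 W Z)
       ({Initial} \<union> range Process \<union> {Channel i t | i t. i \<in> {1..L}})"

text \<open>A policy receives a finite history as a sequence padded with zeros: \<open>prefix_of n x\<close>
  carries exactly the information \<open>x 0, \<dots>, x (n - 1)\<close>.\<close>

definition prefix_of :: "nat \<Rightarrow> (nat \<Rightarrow> real) \<Rightarrow> nat \<Rightarrow> real" where
  "prefix_of n x = (\<lambda>s. if s < n then x s else 0)"

definition slot :: "nat \<Rightarrow> nat \<Rightarrow> nat \<Rightarrow> bool" where
  "slot L k t \<longleftrightarrow> (\<exists>n. t = k + n * L)"

text \<open>The processes \<open>X\<close> (state), \<open>U\<close> (control), \<open>Se\<close> (encoder output), \<open>Y i\<close> and \<open>Sr i\<close>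
  (input and output of relay \<open>i\<close>), \<open>R\<close> (controller input) are the closed loop generated by the
  policies \<open>f\<close>, \<open>g i\<close>, \<open>pol\<close>, which need not be linear here.  For given policies and primitive
  variables these equations determine the processes uniquely for relays \<open>1, \<dots>, L - 1\<close>.\<close>

definition cascade_loop ::
  "nat \<Rightarrow> real \<Rightarrow> real \<Rightarrow>
   ('a \<Rightarrow> real) \<Rightarrow> (nat \<Rightarrow> 'a \<Rightarrow> real) \<Rightarrow> (nat \<Rightarrow> nat \<Rightarrow> 'a \<Rightarrow> real) \<Rightarrow>
   (nat \<Rightarrow> (nat \<Rightarrow> real) \<Rightarrow> (nat \<Rightarrow> real) \<Rightarrow> real) \<Rightarrow>
   (nat \<Rightarrow> nat \<Rightarrow> (nat \<Rightarrow> real) \<Rightarrow> real) \<Rightarrow>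
   (nat \<Rightarrow> (nat \<Rightarrow> real) \<Rightarrow> real) \<Rightarrow>
   (nat \<Rightarrow> 'a \<Rightarrow> real) \<Rightarrow> (nat \<Rightarrow> 'a \<Rightarrow> real) \<Rightarrow> (nat \<Rightarrow> 'a \<Rightarrow> real) \<Rightarrow>
   (nat \<Rightarrow> nat \<Rightarrow> 'a \<Rightarrow> real) \<Rightarrow> (nat \<Rightarrow> nat \<Rightarrow> 'a \<Rightarrow> real) \<Rightarrow> (nat \<Rightarrow> 'a \<Rightarrow> real) \<Rightarrow> bool" where
  "cascade_loop L lam B X0 W Z f g pol X U Se Y Sr R \<longleftrightarrow>
     (\<forall>\<omega>. X 0 \<omega> = X0 \<omega>) \<and>
     (\<forall>t \<omega>. X (Suc t) \<omega> = lam * X t \<omega> + B * U t \<omega> + W t \<omega>) \<and>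
     (\<forall>t \<omega>. Se t \<omega> =
        (if slot L 1 t
         then f t (prefix_of (t + 1) (\<lambda>s. X s \<omega>)) (prefix_of t (\<lambda>s. U s \<omega>)) else 0)) \<and>
     (\<forall>t \<omega>. Y 1 t \<omega> = (if slot L 1 t then Se t \<omega> + Z 1 t \<omega> else 0)) \<and>
     (\<forall>i\<in>{2..L-1}. \<forall>t \<omega>. Y i t \<omega> = (if slot L i t then Sr (i - 1) t \<omega> + Z i t \<omega> else 0)) \<and>
     (\<forall>i\<in>{1..L-1}. \<forall>t \<omega>. Sr i t \<omega> =
        (if slot L (1 + i) t then g i t (prefix_of (t + 1) (\<lambda>s. Y i s \<omega>)) else 0)) \<and>
     (\<forall>t \<omega>. R t \<omega> = (if slot L 0 t then Sr (L - 1) t \<omega> + Z L t \<omega> else 0)) \<and>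
     (\<forall>t \<omega>. U t \<omega> = pol t (prefix_of (t + 1) (\<lambda>s. R s \<omega>)))"

definition linear_functional :: "((nat \<Rightarrow> real) \<Rightarrow> real) \<Rightarrow> bool" where
  "linear_functional F \<longleftrightarrow>
     (\<forall>a b x y. F (\<lambda>s. a * x s + b * y s) = a * F x + b * F y)"

definition jointly_linear :: "((nat \<Rightarrow> real) \<Rightarrow> (nat \<Rightarrow> real) \<Rightarrow> real) \<Rightarrow> bool" where
  "jointly_linear F \<longleftrightarrow>
     (\<forall>a b x u x' u'. F (\<lambda>s. a * x s + b * x' s) (\<lambda>s. a * u s + b * u' s) =
        a * F x u + b * F x' u')"

definition linear_scheme ::
  "nat \<Rightarrow> (nat \<Rightarrow> (nat \<Rightarrow> real) \<Rightarrow> (nat \<Rightarrow> real) \<Rightarrow> real) \<Rightarrow>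
   (nat \<Rightarrow> nat \<Rightarrow> (nat \<Rightarrow> real) \<Rightarrow> real) \<Rightarrow> (nat \<Rightarrow> (nat \<Rightarrow> real) \<Rightarrow> real) \<Rightarrow> bool" where
  "linear_scheme L f g pol \<longleftrightarrow>
     (\<forall>t. jointly_linear (f t)) \<and>
     (\<forall>i\<in>{1..L-1}. \<forall>t. linear_functional (g i t)) \<and>
     (\<forall>t. linear_functional (pol t))"

text \<open>The Bochner integral of a non-integrable function is \<open>0\<close>, hence the explicit
  integrability conditions here and below.\<close>

definition power_constraints ::
  "'a measure \<Rightarrow> nat \<Rightarrow> real \<Rightarrow> (nat \<Rightarrow> real) \<Rightarrow>
   (nat \<Rightarrow> 'a \<Rightarrow> real) \<Rightarrow> (nat \<Rightarrow> nat \<Rightarrow> 'a \<Rightarrow> real) \<Rightarrow> bool" where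
  "power_constraints M L PS P Se Sr \<longleftrightarrow>
     (\<forall>t. slot L 1 t \<longrightarrow>
        integrable M (\<lambda>\<omega>. (Se t \<omega>)\<^sup>2) \<and>
        prob_space.expectation M (\<lambda>\<omega>. (Se t \<omega>)\<^sup>2) = real L * PS) \<and>
     (\<forall>i\<in>{1..L-1}. \<forall>t. slot L (1 + i) t \<longrightarrow>
        integrable M (\<lambda>\<omega>. (Sr i t \<omega>)\<^sup>2) \<and>
        prob_space.expectation M (\<lambda>\<omega>. (Sr i t \<omega>)\<^sup>2) = real L * P i)"

definition mean_square_stable :: "'a measure \<Rightarrow> (nat \<Rightarrow> 'a \<Rightarrow> real) \<Rightarrow> bool" where
  "mean_square_stable M X \<longleftrightarrow>
     (\<exists>C. \<forall>t. integrable M (\<lambda>\<omega>. (X t \<omega>)\<^sup>2) \<and>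
        prob_space.expectation M (\<lambda>\<omega>. (X t \<omega>)\<^sup>2) < C)"

text \<open>Relay powers are families of which only the entries \<open>1, \<dots>, L - 1\<close> matter.\<close>

definition relay_allocations :: "nat \<Rightarrow> real \<Rightarrow> (nat \<Rightarrow> real) set" where
  "relay_allocations L PR = {P. (\<forall>i\<in>{1..L-1}. 0 \<le> P i) \<and> (\<Sum>i=1..L-1. P i) \<le> PR}"

definition linearly_stabilizable ::
  "'a measure \<Rightarrow> nat \<Rightarrow> real \<Rightarrow> real \<Rightarrow> real \<Rightarrow> real \<Rightarrow>
   ('a \<Rightarrow> real) \<Rightarrow> (nat \<Rightarrow> 'a \<Rightarrow> real) \<Rightarrow> (nat \<Rightarrow> nat \<Rightarrow> 'a \<Rightarrow> real) \<Rightarrow> bool" where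
  "linearly_stabilizable M L lam B PS PR X0 W Z \<longleftrightarrow>
     (\<exists>P\<in>relay_allocations L PR. \<exists>f g pol X U Se Y Sr R.
        linear_scheme L f g pol \<and>
        cascade_loop L lam B X0 W Z f g pol X U Se Y Sr R \<and>
        power_constraints M L PS P Se Sr \<and>
        mean_square_stable M X)"

definition cascade_rate :: "nat \<Rightarrow> real \<Rightarrow> (nat \<Rightarrow> real) \<Rightarrow> (nat \<Rightarrow> real) \<Rightarrow> real" where
  "cascade_rate L PS N P =
     1 / (2 * real L) *
     log 2 (1 + real L * PS / (real L * PS + N 1) *
       (\<Prod>i=1..L-1. real L * P i / (real L * P i + N (i + 1))))"

definition optimal_allocation ::
  "nat \<Rightarrow> real \<Rightarrow> real \<Rightarrow> (nat \<Rightarrow> real) \<Rightarrow> (nat \<Rightarrow> real) \<Rightarrow> bool" where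
  "optimal_allocation L PS PR N P \<longleftrightarrow>
     is_arg_max (cascade_rate L PS N) (\<lambda>Q. Q \<in> relay_allocations L PR) P"

text \<open>\<open>L\<close> times this value is the positive root \<open>q\<close> of \<open>q\<^sup>2 + N (i+1) * q + N (i+1) / \<gamma> = 0\<close>,
  the stationarity condition for the transmit power \<open>q = L * P i\<close> of relay \<open>i\<close>.  The paper
  prints the same root without the division by \<open>L\<close>, i.e. as a formula for \<open>P i\<close> itself; for
  \<open>L \<ge> 3\<close> and unequal noise variances that allocation does not maximize \<open>cascade_rate\<close>.\<close>

definition relay_power :: "nat \<Rightarrow> (nat \<Rightarrow> real) \<Rightarrow> real \<Rightarrow> nat \<Rightarrow> real" where
  "relay_power L N \<gamma> i =
     ((- N (i + 1) + sqrt ((N (i + 1))\<^sup>2 - 4 * N (i + 1) / \<gamma>)) / 2) / real L"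

end

theory Submission
  imports Defs
begin

text \<open>In each round of \<open>L\<close> steps the encoder sends a multiple of the state, every relay amplifies
  and forwards what it has just received, all gains being chosen to meet the power constraints
  exactly, and at the end of the round the controller cancels the linear least squares estimate of
  the state.  Every signal is uncorrelated with all noise that has not yet entered the loop, so
  the second moments follow a deterministic recursion.  If \<open>q\<close> is the squared correlation
  coefficient between the state at the beginning of the round and the signal that reaches the
  controller, then the second moment of the state is multiplied by \<open>(lam\<^sup>2) ^ L * (1 - q)\<close> per round, up
  to an additive constant, and \<open>q\<close> is exactly the product inside the logarithm of
  \<open>cascade_rate\<close>.

  The logarithm of that product is a strictly concave function of the relay powers, so the
  stationary point of the Lagrangian is its unique maximizer on the simplex; the intermediate
  value theorem in \<open>- 1 / \<gamma>\<close> makes it exhaust the budget.\<close>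

section \<open>Square integrable random variables\<close>

definition square_integrable :: "'a measure \<Rightarrow> ('a \<Rightarrow> real) \<Rightarrow> bool" where
  "square_integrable M X \<longleftrightarrow> X \<in> borel_measurable M \<and> integrable M (\<lambda>\<omega>. X \<omega> * X \<omega>)"

text \<open>The uncentred inner product of L2: the mean of the initial state is arbitrary, and power
  constraints and stability concern raw second moments.\<close>

definition corr :: "'a measure \<Rightarrow> ('a \<Rightarrow> real) \<Rightarrow> ('a \<Rightarrow> real) \<Rightarrow> real" where
  "corr M X Y = (\<integral>\<omega>. X \<omega> * Y \<omega> \<partial>M)"

lemma corr_commute: "corr M X Y = corr M Y X"
  by (simp add: corr_def mult.commute)

lemma corr_self_nonneg: "0 \<le> corr M X X"
  by (simp add: corr_def)

lemma square_integrable_zero [simp]: "square_integrable M (\<lambda>_. 0)"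
  by (simp add: square_integrable_def)

lemma corr_zero_left [simp]: "corr M (\<lambda>_. 0) Y = 0"
  by (simp add: corr_def)

lemma integrable_mult_square_integrable:
  assumes "square_integrable M X" "square_integrable M Y"
  shows "integrable M (\<lambda>\<omega>. X \<omega> * Y \<omega>)"
proof (rule Bochner_Integration.integrable_bound)
  show "integrable M (\<lambda>\<omega>. X \<omega> * X \<omega> + Y \<omega> * Y \<omega>)"
    using assms by (simp add: square_integrable_def)
  show "(\<lambda>\<omega>. X \<omega> * Y \<omega>) \<in> borel_measurable M"
    using assms by (auto simp: square_integrable_def)
  have "\<bar>a * b\<bar> \<le> a * a + b * b" for a b :: real
  proof -
    have "0 \<le> (\<bar>a\<bar> - \<bar>b\<bar>)\<^sup>2" by simp
    then have "2 * (\<bar>a\<bar> * \<bar>b\<bar>) \<le> a * a + b * b"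
      by (simp add: power2_eq_square algebra_simps flip: abs_mult)
    moreover have "0 \<le> \<bar>a\<bar> * \<bar>b\<bar>" by simp
    ultimately show ?thesis unfolding abs_mult by linarith
  qed
  then show "AE \<omega> in M. norm (X \<omega> * Y \<omega>) \<le> norm (X \<omega> * X \<omega> + Y \<omega> * Y \<omega>)"
    by (simp add: sum_squares_ge_zero)
qed

lemma square_integrable_lincomb:
  assumes "square_integrable M X" "square_integrable M Y"
  shows "square_integrable M (\<lambda>\<omega>. a * X \<omega> + b * Y \<omega>)"
proof -
  have "integrable M (\<lambda>\<omega>. a * a * (X \<omega> * X \<omega>) + 2 * a * b * (X \<omega> * Y \<omega>) + b * b * (Y \<omega> * Y \<omega>))"
    using assms integrable_mult_square_integrable[OF assms] by (simp add: square_integrable_def)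
  then show ?thesis
    using assms by (auto simp: square_integrable_def algebra_simps)
qed

lemma corr_lincomb_left:
  assumes "square_integrable M X" "square_integrable M Y" "square_integrable M V"
  shows "corr M (\<lambda>\<omega>. a * X \<omega> + b * Y \<omega>) V = a * corr M X V + b * corr M Y V"
proof -
  have "corr M (\<lambda>\<omega>. a * X \<omega> + b * Y \<omega>) V = (\<integral>\<omega>. a * (X \<omega> * V \<omega>) + b * (Y \<omega> * V \<omega>) \<partial>M)"
    by (simp add: corr_def algebra_simps)
  then show ?thesis
    using assms by (simp add: corr_def integrable_mult_square_integrable)
qed

lemma corr_lincomb_self:
  assumes "square_integrable M X" "square_integrable M Y"
  shows "corr M (\<lambda>\<omega>. a * X \<omega> + b * Y \<omega>) (\<lambda>\<omega>. a * X \<omega> + b * Y \<omega>) =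
    a\<^sup>2 * corr M X X + 2 * a * b * corr M X Y + b\<^sup>2 * corr M Y Y"
proof -
  let ?V = "\<lambda>\<omega>. a * X \<omega> + b * Y \<omega>"
  have V: "square_integrable M ?V"
    using assms by (rule square_integrable_lincomb)
  have "corr M X ?V = a * corr M X X + b * corr M X Y"
    using corr_lincomb_left[OF assms assms(1)] by (metis corr_commute)
  moreover have "corr M Y ?V = a * corr M X Y + b * corr M Y Y"
    using corr_lincomb_left[OF assms assms(2)] by (metis corr_commute)
  ultimately show ?thesis
    using corr_lincomb_left[OF assms V] by (simp add: power2_eq_square algebra_simps)
qed

lemma square_integrable_integrable_power2:
  "square_integrable M X \<Longrightarrow> integrable M (\<lambda>\<omega>. (X \<omega>)\<^sup>2)"
  by (simp add: square_integrable_def power2_eq_square)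

lemma corr_self_eq_power2: "corr M X X = (\<integral>\<omega>. (X \<omega>)\<^sup>2 \<partial>M)"
  by (simp add: corr_def power2_eq_square)

lemma (in prob_space) normal_zero_mean:
  assumes "distributed M lborel X (\<lambda>x. ennreal (normal_density 0 (sqrt v) x))" "0 < v"
  shows "square_integrable M X" "expectation X = 0" "corr M X X = v"
proof -
  have s: "0 < sqrt v" using assms(2) by simp
  have X: "X \<in> borel_measurable M"
    using distributed_measurable[OF assms(1)] by simp
  have "integrable lborel (\<lambda>x. normal_density 0 (sqrt v) x * (x - 0)\<^sup>2)"
    by (rule integrable_normal_moment[OF s])
  then have "integrable M (\<lambda>\<omega>. (X \<omega>)\<^sup>2)"
    using distributed_integrable[OF assms(1), of "\<lambda>x. x\<^sup>2"] by simp
  then show "square_integrable M X"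
    using X by (simp add: square_integrable_def power2_eq_square)
  show mean: "expectation X = 0"
    using normal_distributed_expectation[OF s, of X 0] assms(1) by simp
  show "corr M X X = v"
    using normal_distributed_variance[OF s, of X 0] assms mean
    by (simp add: corr_self_eq_power2)
qed

section \<open>Second moments of the closed loop\<close>

locale cascade = prob_space M for M :: "'a measure" +
  fixes L :: nat and lam B PS vW :: real and N P :: "nat \<Rightarrow> real"
    and X0 :: "'a \<Rightarrow> real" and W :: "nat \<Rightarrow> 'a \<Rightarrow> real" and Z :: "nat \<Rightarrow> nat \<Rightarrow> 'a \<Rightarrow> real"
  assumes L: "2 \<le> L"
    and lam: "1 \<le> \<bar>lam\<bar>"
    and B: "B \<noteq> 0"
    and PS: "0 < PS"
    and vW: "0 < vW"
    and N: "i \<in> {1..L} \<Longrightarrow> 0 < N i"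
    and P: "i \<in> {1..L-1} \<Longrightarrow> 0 \<le> P i"
    and sources: "cascade_sources M L vW N X0 W Z"
begin

text \<open>The node transmitting at time \<open>t\<close>: node \<open>1\<close> is the encoder, node \<open>i + 1\<close> is relay \<open>i\<close>.\<close>

definition node :: "nat \<Rightarrow> nat" where
  "node t = (if t mod L = 0 then L else t mod L)"

text \<open>The second moment prescribed for the signal of node \<open>j\<close>; relay
  \<open>i\<close> is node \<open>i + 1\<close>, hence the index \<open>j - 1\<close>.\<close>

definition hop_power :: "nat \<Rightarrow> real" where
  "hop_power j = real L * (if j = 1 then PS else P (j - 1))"

text \<open>A real number computed from second moments, not from the realization, so that amplifying
  by it is linear. At time 0 the held signal is 0, and division by 0 makes the gain 0.\<close>

definition gain :: "nat \<Rightarrow> ('a \<Rightarrow> real) \<Rightarrow> real" where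
  "gain t q = sqrt (hop_power (node t) / corr M q q)"

text \<open>The factor 1 keeps the shape \<open>a * X \<omega> + b * Y \<omega>\<close> of the
  lemmas on linear combinations.\<close>

definition received :: "nat \<Rightarrow> ('a \<Rightarrow> real) \<Rightarrow> 'a \<Rightarrow> real" where
  "received t q = (\<lambda>\<omega>. gain t q * q \<omega> + 1 * Z (node t) t \<omega>)"

text \<open>With this gain, \<open>lam * x - B * feedback t x y * y\<close> is the error of the linear least
  squares estimate of \<open>lam * x\<close> given \<open>y\<close>.\<close>

definition feedback :: "nat \<Rightarrow> ('a \<Rightarrow> real) \<Rightarrow> ('a \<Rightarrow> real) \<Rightarrow> real" where
  "feedback t x y = (if node t = L then lam * corr M x y / (B * corr M y y) else 0)"

text \<open>The state of the plant together with the signal held by the node that transmits next.\<close>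

primrec loop :: "nat \<Rightarrow> ('a \<Rightarrow> real) \<times> ('a \<Rightarrow> real)" where
  "loop 0 = (X0, \<lambda>_. 0)"
| "loop (Suc t) =
     (let x = fst (loop t); y = received t (snd (loop t));
          x' = (\<lambda>\<omega>. 1 * (lam * x \<omega> + (- B * feedback t x y) * y \<omega>) + 1 * W t \<omega>)
      in (x', if node t = L then x' else y))"

definition X :: "nat \<Rightarrow> 'a \<Rightarrow> real" where "X t = fst (loop t)"
definition Q :: "nat \<Rightarrow> 'a \<Rightarrow> real" where "Q t = snd (loop t)"
text \<open>One process serves all hops, because only one node transmits at a time.\<close>

definition Y :: "nat \<Rightarrow> 'a \<Rightarrow> real" where "Y t = received t (Q t)"
definition K :: "nat \<Rightarrow> real" where "K t = feedback t (X t) (Y t)"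
definition S :: "nat \<Rightarrow> 'a \<Rightarrow> real" where "S t \<omega> = gain t (Q t) * Q t \<omega>"

lemma X_0: "X 0 = X0" and Q_0: "Q 0 = (\<lambda>_. 0)"
  by (simp_all add: X_def Q_def)

lemma Y_eq: "Y t = (\<lambda>\<omega>. gain t (Q t) * Q t \<omega> + 1 * Z (node t) t \<omega>)"
  by (simp add: Y_def received_def)

lemma X_Suc: "X (Suc t) = (\<lambda>\<omega>. 1 * (lam * X t \<omega> + (- B * K t) * Y t \<omega>) + 1 * W t \<omega>)"
  by (simp add: X_def Q_def Y_def K_def Let_def)

lemma Q_Suc: "Q (Suc t) = (if node t = L then X (Suc t) else Y t)"
  by (simp add: X_def Q_def Y_def Let_def)

lemma node_range: "node t \<in> {1..L}"
  using L mod_less_divisor[of L t] by (auto simp: node_def simp del: mod_less_divisor)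

lemma hop_power_nonneg: "j \<in> {1..L} \<Longrightarrow> 0 \<le> hop_power j"
proof (cases "j = 1")
  case False
  assume "j \<in> {1..L}"
  with False have "j - 1 \<in> {1..L-1}" by auto
  then show ?thesis
    using False P by (auto simp: hop_power_def intro!: mult_nonneg_nonneg)
qed (use PS in \<open>simp add: hop_power_def\<close>)

section \<open>Orthogonality of the signals to future noise\<close>

abbreviation src :: "source \<Rightarrow> 'a \<Rightarrow> real" where "src \<equiv> source_var X0 W Z"

text \<open>Indices of the noise variables that enter the loop at time \<open>t\<close> or
  later.\<close>

definition noise :: "nat \<Rightarrow> source set" where
  "noise t = Process ` {t..} \<union> {Channel i u | i u. i \<in> {1..L} \<and> t \<le> u}"

text \<open>A second-order substitute for causality: it is preserved by linear combinations and
  suffices for computing second moments.\<close>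

definition known :: "nat \<Rightarrow> ('a \<Rightarrow> real) \<Rightarrow> bool" where
  "known t V \<longleftrightarrow> square_integrable M V \<and> (\<forall>s\<in>noise t. corr M V (src s) = 0)"

lemma noise_antimono: "noise (Suc t) \<subseteq> noise t"
  by (auto simp: noise_def)

lemma noise_subset: "noise t \<subseteq> {Initial} \<union> range Process \<union> {Channel i t | i t. i \<in> {1..L}}"
  by (auto simp: noise_def)

lemma W_moments: "square_integrable M (W t)" "expectation (W t) = 0" "corr M (W t) (W t) = vW"
  using normal_zero_mean[of "W t" vW] sources vW by (auto simp: cascade_sources_def)

lemma Z_moments:
  assumes "i \<in> {1..L}"
  shows "square_integrable M (Z i t)" "expectation (Z i t) = 0" "corr M (Z i t) (Z i t) = N i"
  using normal_zero_mean[of "Z i t" "N i"] sources N[OF assms] assms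
  by (auto simp: cascade_sources_def)

lemma X0_square_integrable: "square_integrable M X0"
proof -
  obtain f where "distributed M lborel X0 (\<lambda>x. ennreal (f x))"
    using sources by (auto simp: cascade_sources_def finite_differential_entropy_def)
  then have "X0 \<in> borel_measurable M"
    using distributed_measurable by fastforce
  then show ?thesis
    using sources by (simp add: cascade_sources_def square_integrable_def power2_eq_square)
qed

lemma src_square_integrable:
  assumes "s \<in> {Initial} \<union> range Process \<union> {Channel i t | i t. i \<in> {1..L}}"
  shows "square_integrable M (src s)"
  using assms W_moments(1) Z_moments(1) X0_square_integrable by auto

text \<open>Independence factorizes the expectation of the product, and the factor
  \<open>src b\<close> is centred; \<open>a\<close> may be \<open>Initial\<close>, whose mean is
  arbitrary.\<close>

lemma src_uncorrelated:
  assumes a: "a \<in> {Initial} \<union> range Process \<union> {Channel i t | i t. i \<in> {1..L}}"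
    and b: "b \<in> noise t" and ab: "a \<noteq> b"
  shows "corr M (src a) (src b) = 0"
proof -
  have sub: "{a, b} \<subseteq> {Initial} \<union> range Process \<union> {Channel i t | i t. i \<in> {1..L}}"
    using a b noise_subset by blast
  have "indep_vars (\<lambda>_. borel) src {a, b}"
    using sources indep_vars_subset[OF _ sub, of "\<lambda>_. borel" src]
    unfolding cascade_sources_def by blast
  moreover have "integrable M (src i)" if "i \<in> {a, b}" for i
  proof -
    have "square_integrable M (src i)"
      using that sub by (intro src_square_integrable) blast
    then show ?thesis
      by (auto simp: square_integrable_def power2_eq_square intro: square_integrable_imp_integrable)
  qed
  ultimately have "(\<integral>\<omega>. (\<Prod>i\<in>{a, b}. src i \<omega>) \<partial>M) = (\<Prod>i\<in>{a, b}. expectation (src i))"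
    by (intro indep_vars_lebesgue_integral) blast+
  moreover have "expectation (src b) = 0"
    using b W_moments(2) Z_moments(2) by (auto simp: noise_def)
  ultimately show ?thesis
    using ab by (simp add: corr_def)
qed

lemma known_lincomb:
  assumes "known t V" "known t V'"
  shows "known t (\<lambda>\<omega>. a * V \<omega> + b * V' \<omega>)"
proof -
  have "corr M (\<lambda>\<omega>. a * V \<omega> + b * V' \<omega>) (src s) = 0" if "s \<in> noise t" for s
    using assms that src_square_integrable[of s] noise_subset[of t]
    by (subst corr_lincomb_left) (auto simp: known_def)
  then show ?thesis
    using assms by (simp add: known_def square_integrable_lincomb)
qed

lemma known_Suc: "known t V \<Longrightarrow> known (Suc t) V"
  using noise_antimono by (auto simp: known_def)

lemma known_src:
  assumes "s \<in> {Initial} \<union> range Process \<union> {Channel i t | i t. i \<in> {1..L}}" "s \<notin> noise t"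
  shows "known t (src s)"
  unfolding known_def
  using assms src_uncorrelated[OF assms(1)] src_square_integrable[OF assms(1)] by metis

text \<open>Step \<open>t\<close> mixes in only \<open>W t\<close> and \<open>Z (node t) t\<close>,
  which are no longer in \<open>noise (Suc t)\<close>; everything else is a linear combination of
  earlier signals.\<close>

lemma known_X_Q: "known t (X t) \<and> known t (Q t)"
proof (induction t)
  case 0
  show ?case
    using known_src[of Initial 0] by (auto simp: X_0 Q_0 known_def noise_def)
next
  case (Suc t)
  have "known (Suc t) (src (Process t))" "known (Suc t) (src (Channel (node t) t))"
    using node_range by (auto intro!: known_src simp: noise_def simp del: source_var.simps)
  then have W: "known (Suc t) (W t)" and Z: "known (Suc t) (Z (node t) t)"
    by simp_all
  have XQ: "known (Suc t) (X t)" "known (Suc t) (Q t)"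
    using Suc by (simp_all add: known_Suc)
  have Y: "known (Suc t) (Y t)"
    unfolding Y_eq by (intro known_lincomb XQ Z)
  have X: "known (Suc t) (X (Suc t))"
    unfolding X_Suc by (intro known_lincomb XQ Y W)
  show ?case using X Y by (simp add: Q_Suc)
qed

lemma X_square_integrable: "square_integrable M (X t)"
  and Q_square_integrable: "square_integrable M (Q t)"
  using known_X_Q[of t] by (auto simp: known_def)

lemma Z_uncorrelated: "corr M (X t) (Z (node t) t) = 0" "corr M (Q t) (Z (node t) t) = 0"
proof -
  have "Channel (node t) t \<in> noise t"
    using node_range by (auto simp: noise_def)
  then show "corr M (X t) (Z (node t) t) = 0" "corr M (Q t) (Z (node t) t) = 0"
    using known_X_Q[of t] by (force simp: known_def)+
qed

lemma W_uncorrelated: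
  "corr M (X t) (W t) = 0" "corr M (Q t) (W t) = 0" "corr M (Z (node t) t) (W t) = 0"
proof -
  have W: "Process t \<in> noise t" by (simp add: noise_def)
  then show "corr M (X t) (W t) = 0" "corr M (Q t) (W t) = 0"
    using known_X_Q[of t] by (force simp: known_def)+
  show "corr M (Z (node t) t) (W t) = 0"
    using src_uncorrelated[OF _ W, of "Channel (node t) t"] node_range by auto
qed

section \<open>One-step recursions for second moments\<close>

lemma Y_square_integrable: "square_integrable M (Y t)"
  unfolding Y_eq
  by (intro square_integrable_lincomb Q_square_integrable Z_moments node_range)

lemma corr_Y_Y: "corr M (Y t) (Y t) = (gain t (Q t))\<^sup>2 * corr M (Q t) (Q t) + N (node t)"
  unfolding Y_eq
  by (subst corr_lincomb_self[OF Q_square_integrable Z_moments(1)[OF node_range]])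
     (simp add: Z_uncorrelated Z_moments(3)[OF node_range])

lemma corr_X_Y: "corr M (X t) (Y t) = gain t (Q t) * corr M (X t) (Q t)"
  unfolding Y_eq
  by (subst corr_commute,
      subst corr_lincomb_left[OF Q_square_integrable Z_moments(1)[OF node_range] X_square_integrable])
     (simp add: Z_uncorrelated corr_commute[of _ _ "X t"])

lemma corr_Y_W: "corr M (Y t) (W t) = 0"
  unfolding Y_eq
  by (subst corr_lincomb_left[OF Q_square_integrable Z_moments(1)[OF node_range] W_moments(1)])
     (simp add: W_uncorrelated)

lemma corr_Y_pos: "0 < corr M (Y t) (Y t)"
  unfolding corr_Y_Y using N[OF node_range, of t] corr_self_nonneg[of M "Q t"]
  by (simp add: add_nonneg_pos)

lemma corr_X_Suc:
  "corr M (X (Suc t)) (X (Suc t)) =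
     lam\<^sup>2 * corr M (X t) (X t) - 2 * lam * B * K t * corr M (X t) (Y t)
       + (B * K t)\<^sup>2 * corr M (Y t) (Y t) + vW"
  and corr_X_Suc_pos: "0 < corr M (X (Suc t)) (X (Suc t))"
  and corr_X_Suc_Y:
  "corr M (X (Suc t)) (Y t) = lam * corr M (X t) (Y t) - B * K t * corr M (Y t) (Y t)"
proof -
  \<comment> \<open>The next state before the process noise enters. The claims split off
    \<open>W t\<close>, which is orthogonal to both \<open>?E\<close> and
    \<open>Y t\<close>.\<close>
  let ?E = "\<lambda>\<omega>. lam * X t \<omega> + (- B * K t) * Y t \<omega>"
  have E: "square_integrable M ?E"
    by (intro square_integrable_lincomb X_square_integrable Y_square_integrable)
  have EW: "corr M ?E (W t) = 0"
    by (subst corr_lincomb_left[OF X_square_integrable Y_square_integrable W_moments(1)])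
       (simp add: corr_Y_W W_uncorrelated)
  have X: "corr M (X (Suc t)) (X (Suc t)) = corr M ?E ?E + vW"
    unfolding X_Suc by (subst corr_lincomb_self[OF E W_moments(1)], subst EW) (simp add: W_moments)
  show "0 < corr M (X (Suc t)) (X (Suc t))"
    unfolding X using corr_self_nonneg[of M ?E] vW by linarith
  show "corr M (X (Suc t)) (X (Suc t)) =
     lam\<^sup>2 * corr M (X t) (X t) - 2 * lam * B * K t * corr M (X t) (Y t)
       + (B * K t)\<^sup>2 * corr M (Y t) (Y t) + vW"
    unfolding X
    by (subst corr_lincomb_self[OF X_square_integrable Y_square_integrable])
       (simp add: algebra_simps)
  have "corr M ?E (Y t) = lam * corr M (X t) (Y t) - B * K t * corr M (Y t) (Y t)"
    by (subst corr_lincomb_left[OF X_square_integrable Y_square_integrable Y_square_integrable]) simp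
  moreover have "corr M (X (Suc t)) (Y t) = corr M ?E (Y t)"
    unfolding X_Suc
    by (subst corr_lincomb_left[OF E W_moments(1) Y_square_integrable])
       (simp add: corr_commute[of _ "W t"] corr_Y_W)
  ultimately show
    "corr M (X (Suc t)) (Y t) = lam * corr M (X t) (Y t) - B * K t * corr M (Y t) (Y t)"
    by simp
qed

text \<open>The held signal contains fresh process or channel noise of positive variance, so from
  time 1 on \<open>gain\<close> never divides by 0 and the powers are met exactly.\<close>

lemma corr_Q_Suc_pos: "0 < corr M (Q (Suc t)) (Q (Suc t))"
  by (simp add: Q_Suc corr_X_Suc_pos corr_Y_pos)

lemma gain_power2:
  "(gain (Suc t) (Q (Suc t)))\<^sup>2 * corr M (Q (Suc t)) (Q (Suc t)) = hop_power (node (Suc t))"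
  using hop_power_nonneg[OF node_range, of "Suc t"] corr_Q_Suc_pos[of t]
  by (simp add: gain_def)

lemma K_eq_zero: "node t \<noteq> L \<Longrightarrow> K t = 0"
  by (simp add: K_def feedback_def)

lemma corr_X_Suc_no_control:
  "node t \<noteq> L \<Longrightarrow> corr M (X (Suc t)) (X (Suc t)) = lam\<^sup>2 * corr M (X t) (X t) + vW"
  by (simp add: corr_X_Suc K_eq_zero)

text \<open>\<open>B * K t\<close> is the coefficient of the projection of \<open>lam * X t\<close>
  on \<open>Y t\<close>, so the cross term and the quadratic term combine to minus the explained
  part.\<close>

lemma corr_X_Suc_control:
  assumes "node t = L"
  shows "corr M (X (Suc t)) (X (Suc t)) =
    lam\<^sup>2 * (corr M (X t) (X t) - (corr M (X t) (Y t))\<^sup>2 / corr M (Y t) (Y t)) + vW"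
proof -
  have BK: "B * K t = lam * corr M (X t) (Y t) / corr M (Y t) (Y t)"
    using assms B by (simp add: K_def feedback_def)
  have "corr M (X (Suc t)) (X (Suc t)) =
     lam\<^sup>2 * corr M (X t) (X t) - 2 * lam * (B * K t) * corr M (X t) (Y t)
       + (B * K t)\<^sup>2 * corr M (Y t) (Y t) + vW"
    by (simp add: corr_X_Suc mult.assoc)
  then show ?thesis
    unfolding BK using corr_Y_pos[of t] by (simp add: power2_eq_square field_simps)
qed

section \<open>Second moments over one round, at times \<open>n * L + 1\<close> to
  \<open>n * L + L\<close>\<close>

lemma node_eq: "j < L \<Longrightarrow> node (Suc (n * L + j)) = Suc j"
  using L by (cases "Suc j = L") (simp_all add: node_def flip: add_Suc_right)

lemma node_multiple: "node (n * L) = L"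
  by (simp add: node_def)

text \<open>The squared correlation coefficient between the state at the beginning of a round and
  the signal received by the \<open>j\<close>-th hop.\<close>

definition quality :: "nat \<Rightarrow> real" where
  "quality j = (\<Prod>i=1..j. hop_power i / (hop_power i + N i))"

text \<open>What \<open>j\<close> steps of process noise contribute to the second moment of the
  uncontrolled state.\<close>

definition accumulated :: "nat \<Rightarrow> real" where
  "accumulated j = vW * (\<Sum>i<j. (lam\<^sup>2) ^ i)"

definition V :: "nat \<Rightarrow> real" where
  "V n = corr M (X (Suc (n * L))) (X (Suc (n * L)))"

lemma accumulated_Suc: "accumulated (Suc j) = lam\<^sup>2 * accumulated j + vW"
proof -
  have "(\<Sum>i<Suc j. (lam\<^sup>2) ^ i) = 1 + lam\<^sup>2 * (\<Sum>i<j. (lam\<^sup>2) ^ i)"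
    unfolding sum.lessThan_Suc_shift by (simp add: sum_distrib_left)
  then show ?thesis by (simp add: accumulated_def algebra_simps)
qed

lemma quality_Suc: "quality (Suc j) = quality j * (hop_power (Suc j) / (hop_power (Suc j) + N (Suc j)))"
  by (simp add: quality_def)

lemma corr_Y_Y_Suc: "corr M (Y (Suc t)) (Y (Suc t)) = hop_power (node (Suc t)) + N (node (Suc t))"
  by (simp add: corr_Y_Y gain_power2)

lemma round_corr_X_X:
  "j < L \<Longrightarrow> corr M (X (Suc (n * L + j))) (X (Suc (n * L + j))) = (lam\<^sup>2) ^ j * V n + accumulated j"
proof (induction j)
  case 0
  show ?case by (simp add: V_def accumulated_def)
next
  case (Suc j)
  then have "node (Suc (n * L + j)) \<noteq> L"
    using node_eq[of j n] by simp
  from corr_X_Suc_no_control[OF this] show ?case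
    using Suc by (simp add: accumulated_Suc algebra_simps)
qed

text \<open>Amplification leaves the squared correlation coefficient unchanged; the channel noise
  raises the second moment from \<open>hop_power\<close> to \<open>hop_power + N\<close>, which is
  the new factor in \<open>quality\<close>. The identity is multiplied out to avoid
  quotients.\<close>

lemma round_corr_X_Q_imp_Y:
  fixes j n
  defines "t \<equiv> Suc (n * L + j)"
  assumes j: "j < L"
    and Q: "(corr M (X t) (Q t))\<^sup>2 = (lam\<^sup>2) ^ j * V n * corr M (Q t) (Q t) * quality j"
  shows "(corr M (X t) (Y t))\<^sup>2 = (lam\<^sup>2) ^ j * V n * corr M (Y t) (Y t) * quality (Suc j)"
proof -
  have pN: "hop_power (Suc j) + N (Suc j) \<noteq> 0"
    using hop_power_nonneg[of "Suc j"] N[of "Suc j"] j by auto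
  have node: "node t = Suc j"
    unfolding t_def by (rule node_eq[OF j])
  have "(corr M (X t) (Y t))\<^sup>2 =
      (lam\<^sup>2) ^ j * V n * ((gain t (Q t))\<^sup>2 * corr M (Q t) (Q t)) * quality j"
    unfolding corr_X_Y power_mult_distrib Q by (simp only: mult_ac)
  also have "(gain t (Q t))\<^sup>2 * corr M (Q t) (Q t) = hop_power (Suc j)"
    using gain_power2[of "n * L + j"] node by (simp add: t_def)
  also have "(lam\<^sup>2) ^ j * V n * hop_power (Suc j) * quality j =
      (lam\<^sup>2) ^ j * V n * (hop_power (Suc j) + N (Suc j)) * quality (Suc j)"
    using pN by (simp add: quality_Suc)
  also have "hop_power (Suc j) + N (Suc j) = corr M (Y t) (Y t)"
    using corr_Y_Y_Suc[of "n * L + j"] node by (simp add: t_def)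
  finally show ?thesis .
qed

text \<open>Between hops the state is only multiplied by \<open>lam\<close> and perturbed by noise
  orthogonal to \<open>Y t\<close>, which the next relay holds. Squaring removes the signs of
  \<open>lam\<close> and of the correlation.\<close>

lemma round_corr_X_Q:
  "j < L \<Longrightarrow> (corr M (X (Suc (n * L + j))) (Q (Suc (n * L + j))))\<^sup>2 =
    (lam\<^sup>2) ^ j * V n * corr M (Q (Suc (n * L + j))) (Q (Suc (n * L + j))) * quality j"
proof (induction j)
  case 0
  have "Q (Suc (n * L)) = X (Suc (n * L))"
    by (simp add: Q_Suc node_multiple)
  then show ?case by (simp add: V_def power2_eq_square quality_def)
next
  case (Suc j)
  define t where "t = Suc (n * L + j)"
  have j: "j < L" using Suc by simp
  have node: "node t \<noteq> L"
    using node_eq[OF j, of n] Suc.prems by (simp add: t_def)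
  have "corr M (X (Suc t)) (Q (Suc t)) = lam * corr M (X t) (Y t)"
    by (simp add: Q_Suc node corr_X_Suc_Y K_eq_zero)
  then have "(corr M (X (Suc t)) (Q (Suc t)))\<^sup>2 = lam\<^sup>2 * (corr M (X t) (Y t))\<^sup>2"
    by (simp add: power_mult_distrib)
  also have "(corr M (X t) (Y t))\<^sup>2 = (lam\<^sup>2) ^ j * V n * corr M (Y t) (Y t) * quality (Suc j)"
    unfolding t_def by (rule round_corr_X_Q_imp_Y[OF j Suc.IH[OF j]])
  finally show ?case
    by (simp add: t_def[symmetric] Q_Suc node)
qed

lemmas round_corr_X_Y = round_corr_X_Q_imp_Y[OF _ round_corr_X_Q]

text \<open>The first \<open>L - 1\<close> steps are uncontrolled; the last one removes the share
  \<open>quality L\<close> of the part of the second moment inherited from the start of the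
  round.\<close>

lemma V_Suc: "V (Suc n) = (lam\<^sup>2) ^ L * (1 - quality L) * V n + accumulated L"
proof -
  obtain k where k: "L = Suc k" using L by (cases L) auto
  let ?t = "Suc (n * L + k)"
  have kL: "k < L" and t: "Suc n * L = ?t" by (simp_all add: k)
  have "node ?t = L" using node_eq[OF kL] k by simp
  then have "V (Suc n) =
      lam\<^sup>2 * (corr M (X ?t) (X ?t) - (corr M (X ?t) (Y ?t))\<^sup>2 / corr M (Y ?t) (Y ?t)) + vW"
    unfolding V_def t by (rule corr_X_Suc_control)
  also have "\<dots> = lam\<^sup>2 * ((lam\<^sup>2) ^ k * V n + accumulated k - (lam\<^sup>2) ^ k * V n * quality L) + vW"
    using round_corr_X_X[OF kL, of n] round_corr_X_Y[OF kL kL, of n] corr_Y_pos[of ?t] by (simp flip: k)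
  also have "\<dots> = (lam\<^sup>2) ^ L * (1 - quality L) * V n + accumulated L"
    by (simp add: k accumulated_Suc algebra_simps)
  finally show ?thesis .
qed

section \<open>Mean square boundedness of the state\<close>

lemma V_nonneg: "0 \<le> V n"
  by (simp add: V_def corr_self_nonneg)

lemma quality_bounds: "0 \<le> quality L" "quality L \<le> 1"
proof -
  have "0 \<le> hop_power i / (hop_power i + N i) \<and> hop_power i / (hop_power i + N i) \<le> 1" if "i \<in> {1..L}" for i
    using hop_power_nonneg[OF that] N[OF that] by (simp add: divide_le_eq_1)
  then show "0 \<le> quality L" "quality L \<le> 1"
    by (auto simp: quality_def intro!: prod_nonneg prod_le_1)
qed

lemma accumulated_mono: "i \<le> j \<Longrightarrow> accumulated i \<le> accumulated j"
  using vW by (auto simp: accumulated_def intro!: mult_left_mono sum_mono2)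

lemma V_bounded:
  assumes "(lam\<^sup>2) ^ L * (1 - quality L) < 1"
  shows "\<exists>C. \<forall>n. V n \<le> C"
proof -
  define a where "a = (lam\<^sup>2) ^ L * (1 - quality L)"
  \<comment> \<open>At or above the fixed point of the affine recursion for \<open>V\<close>, so the
    bound reproduces itself; the maximum also covers the first round.\<close>
  define C where "C = max (V 0) (accumulated L / (1 - a))"
  have a: "0 \<le> a" "a < 1"
    using assms quality_bounds by (simp_all add: a_def)
  have "V n \<le> C" for n
  proof (induction n)
    case 0
    show ?case by (simp add: C_def)
  next
    case (Suc n)
    have "accumulated L \<le> (1 - a) * C"
      using a by (simp add: C_def max_def field_simps)
    moreover have "a * V n \<le> a * C"
      using a Suc by (simp add: mult_left_mono)
    moreover have "V (Suc n) = a * V n + accumulated L"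
      by (simp add: V_Suc a_def)
    ultimately show ?case
      by (simp add: left_diff_distrib)
  qed
  then show ?thesis by blast
qed

lemma X_mean_square_stable:
  assumes "(lam\<^sup>2) ^ L * (1 - quality L) < 1"
  shows "mean_square_stable M X"
proof -
  obtain C where C: "\<And>n. V n \<le> C"
    using V_bounded[OF assms] by blast
  have C0: "0 \<le> C" using C[of 0] V_nonneg[of 0] by linarith
  have lam2: "1 \<le> lam\<^sup>2" using lam by (simp add: abs_le_square_iff[of 1, simplified])
  have Suc: "corr M (X (Suc t)) (X (Suc t)) \<le> (lam\<^sup>2) ^ L * C + accumulated L" for t
  proof -
    define n j where "n = t div L" and "j = t mod L"
    have j: "j < L" and t: "t = n * L + j"
      using L by (simp_all add: n_def j_def)
    have "corr M (X (Suc t)) (X (Suc t)) = (lam\<^sup>2) ^ j * V n + accumulated j"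
      unfolding t by (rule round_corr_X_X[OF j])
    also have "\<dots> \<le> (lam\<^sup>2) ^ L * C + accumulated L"
      using j lam2 C[of n] C0 V_nonneg[of n]
      by (intro add_mono mult_mono accumulated_mono power_increasing) auto
    finally show ?thesis .
  qed
  \<comment> \<open>Time 0 precedes the first round and is bounded separately; the added 1 makes the
    inequality strict.\<close>
  define D where "D = max (corr M (X 0) (X 0)) ((lam\<^sup>2) ^ L * C + accumulated L) + 1"
  have "corr M (X t) (X t) < D" for t
    using Suc[of "t - 1"] by (cases t) (auto simp: D_def less_max_iff_disj intro: le_less_trans)
  then show ?thesis
    using square_integrable_integrable_power2[OF X_square_integrable]
    by (auto simp: mean_square_stable_def simp flip: corr_self_eq_power2)
qed

section \<open>Realization of the loop by a linear scheme\<close>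

lemma slot_iff_node: "k \<in> {1..L} \<Longrightarrow> slot L k t \<longleftrightarrow> 0 < t \<and> node t = k"
proof
  assume k: "k \<in> {1..L}" and "slot L k t"
  then obtain n where t: "t = k + n * L" by (auto simp: slot_def)
  have "t = Suc (n * L + (k - 1))" "k - 1 < L" using k t by auto
  then show "0 < t \<and> node t = k" using node_eq[of "k - 1" n] k by simp
next
  assume k: "k \<in> {1..L}" and t: "0 < t \<and> node t = k"
  define n j where "n = (t - 1) div L" and "j = (t - 1) mod L"
  have "j < L" "t = Suc (n * L + j)"
    using L t by (simp_all add: n_def j_def)
  then show "slot L k t"
    using t node_eq[of j n] by (auto simp: slot_def intro!: exI[of _ n])
qed

text \<open>Time 0 is a reception slot of the controller although it is no transmission slot of
  relay \<open>L - 1\<close>; hence no condition \<open>0 < t\<close> as in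
  \<open>slot_iff_node\<close>.\<close>

lemma slot_0_iff_node: "slot L 0 t \<longleftrightarrow> node t = L"
proof -
  have "t mod L \<noteq> L" using L mod_less_divisor[of L t] by linarith
  then show ?thesis
    by (auto simp: slot_def node_def mult.commute simp flip: dvd_eq_mod_eq_0)
qed

lemma node_Suc: "node (Suc t) = (if node t = L then 1 else Suc (node t))"
proof -
  define n j where "n = t div L" and "j = t mod L"
  have j: "j < L" "t = n * L + j"
    using L by (simp_all add: n_def j_def)
  have "node (Suc t) = Suc j" using node_eq[OF j(1), of n] j(2) by simp
  moreover have "node t = (if j = 0 then L else j)" by (simp add: node_def j_def)
  ultimately show ?thesis using j(1) by auto
qed

text \<open>The slot before an encoder slot is the last of a round, where the held signal is reset
  to the current state.\<close>

lemma Q_encoder: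
  assumes "0 < t" "node t = 1"
  shows "Q t = X t"
proof (cases t)
  case (Suc s)
  have "node s = L"
  proof (rule ccontr)
    assume "node s \<noteq> L"
    then have "node t = Suc (node s)" using Suc by (simp add: node_Suc)
    then show False using assms node_range[of s] by simp
  qed
  then show ?thesis using Suc by (simp add: Q_Suc)
qed (use assms in simp)

text \<open>Shows that the relay really possesses what it forwards: its own reception one step
  earlier, in a slot where its input is not set to 0.\<close>

lemma Q_relay:
  assumes "0 < t" "node t = Suc i" "i \<in> {1..L-1}"
  shows "Q t = Y (t - 1)" "slot L i (t - 1)"
proof -
  obtain s where s: "t = Suc s" using assms(1) by (cases t) auto
  have n: "node s = i" "i \<noteq> L" using assms s by (auto simp: node_Suc split: if_splits)
  then show "Q t = Y (t - 1)" by (simp add: s Q_Suc)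
  \<comment> \<open>\<open>node 0\<close> is \<open>L\<close>, which is no relay's reception
    slot.\<close>
  have "s \<noteq> 0" using n by (metis node_def mod_0)
  then show "slot L i (t - 1)"
    using n assms(3) by (subst slot_iff_node) (auto simp: s)
qed

lemma S_moments:
  assumes "k \<in> {1..L}" "slot L k t"
  shows "integrable M (\<lambda>\<omega>. (S t \<omega>)\<^sup>2)" "expectation (\<lambda>\<omega>. (S t \<omega>)\<^sup>2) = hop_power k"
proof -
  have t: "0 < t" "node t = k" using assms slot_iff_node by auto
  then obtain s where s: "t = Suc s" by (cases t) auto
  have int: "integrable M (\<lambda>\<omega>. (Q t \<omega>)\<^sup>2)"
    by (rule square_integrable_integrable_power2[OF Q_square_integrable])
  then show "integrable M (\<lambda>\<omega>. (S t \<omega>)\<^sup>2)"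
    by (simp add: S_def power_mult_distrib)
  have "expectation (\<lambda>\<omega>. (S t \<omega>)\<^sup>2) = (gain t (Q t))\<^sup>2 * corr M (Q t) (Q t)"
    by (simp add: S_def power_mult_distrib corr_self_eq_power2)
  then show "expectation (\<lambda>\<omega>. (S t \<omega>)\<^sup>2) = hop_power k"
    using gain_power2[of s] t by (simp add: s)
qed

lemma S_0: "S 0 \<omega> = 0"
  by (simp add: S_def Q_0)

lemma Y_eq_S: "Y t \<omega> = S t \<omega> + Z (node t) t \<omega>"
  by (simp add: Y_eq S_def)

lemma linearly_stabilizable_if:
  assumes stable: "(lam\<^sup>2) ^ L * (1 - quality L) < 1"
    and alloc: "P \<in> relay_allocations L PR"
  shows "linearly_stabilizable M L lam B PS PR X0 W Z"
proof -
  \<comment> \<open>The coefficients are constants fixed in advance, so all policies are linear. A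
    relay reads its reception of the preceding step, hence \<open>t - 1\<close>.\<close>
  define f where "f t x u = gain t (Q t) * x t" for t and x u :: "nat \<Rightarrow> real"
  define g where "g i t y = gain t (Q t) * y (t - 1)" for i t :: nat and y :: "nat \<Rightarrow> real"
  define pol where "pol t r = - K t * r t" for t and r :: "nat \<Rightarrow> real"
  define Se where "Se t \<omega> = (if slot L 1 t then S t \<omega> else 0)" for t \<omega>
  define Sr where "Sr i t \<omega> = (if slot L (1 + i) t then S t \<omega> else 0)" for i t \<omega>
  define Yr where "Yr i t \<omega> = (if slot L i t then Y t \<omega> else 0)" for i t \<omega>
  define R where "R t \<omega> = (if slot L 0 t then Y t \<omega> else 0)" for t \<omega>
  define U where "U t \<omega> = - K t * R t \<omega>" for t \<omega>
  have "linear_scheme L f g pol"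
    by (simp add: linear_scheme_def jointly_linear_def linear_functional_def f_def g_def pol_def
        algebra_simps)
  moreover have "cascade_loop L lam B X0 W Z f g pol X U Se Yr Sr R"
    unfolding cascade_loop_def
  proof (intro conjI allI ballI)
    show "X 0 \<omega> = X0 \<omega>" for \<omega> by (simp add: X_0)
    \<comment> \<open>Outside the controller's slots \<open>R\<close> is 0, which agrees with
      \<open>X_Suc\<close> because \<open>K t\<close> vanishes there.\<close>
    show "X (Suc t) \<omega> = lam * X t \<omega> + B * U t \<omega> + W t \<omega>" for t \<omega>
      using K_eq_zero[of t] by (simp add: X_Suc U_def R_def slot_0_iff_node)
    show "Se t \<omega> = (if slot L 1 t
         then f t (prefix_of (t + 1) (\<lambda>s. X s \<omega>)) (prefix_of t (\<lambda>s. U s \<omega>)) else 0)" for t \<omega>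
      using Q_encoder[of t] L
      by (simp add: Se_def f_def prefix_of_def S_def slot_iff_node)
    show "Yr 1 t \<omega> = (if slot L 1 t then Se t \<omega> + Z 1 t \<omega> else 0)" for t \<omega>
      using L by (simp add: Yr_def Se_def Y_eq_S slot_iff_node)
    show "Yr i t \<omega> = (if slot L i t then Sr (i - 1) t \<omega> + Z i t \<omega> else 0)"
      if "i \<in> {2..L-1}" for i t \<omega>
      using that by (auto simp: Yr_def Sr_def Y_eq_S slot_iff_node)
    show "Sr i t \<omega> = (if slot L (1 + i) t then g i t (prefix_of (t + 1) (\<lambda>s. Yr i s \<omega>)) else 0)"
      if i: "i \<in> {1..L-1}" for i t \<omega>
    proof (cases "slot L (1 + i) t")
      case True
      have "1 + i \<in> {1..L}" using i by auto
      then have t: "0 < t" "node t = Suc i" using True slot_iff_node by auto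
      show ?thesis
        using True Q_relay[OF t i]
        by (simp add: Sr_def g_def prefix_of_def Yr_def S_def)
    qed (simp add: Sr_def)
    \<comment> \<open>At time 0 no relay transmits and the controller receives pure noise; this fits
      because \<open>S 0\<close> is 0.\<close>
    show "R t \<omega> = (if slot L 0 t then Sr (L - 1) t \<omega> + Z L t \<omega> else 0)" for t \<omega>
      using L S_0 by (cases "t = 0") (auto simp: R_def Sr_def Y_eq_S slot_iff_node slot_0_iff_node)
    show "U t \<omega> = pol t (prefix_of (t + 1) (\<lambda>s. R s \<omega>))" for t \<omega>
      by (simp add: U_def pol_def prefix_of_def)
  qed
  moreover have "power_constraints M L PS P Se Sr"
  proof -
    have relay: "hop_power (1 + i) = real L * P i" "1 + i \<in> {1..L}" if "i \<in> {1..L-1}" for i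
      using that L by (auto simp: hop_power_def)
    have encoder: "hop_power 1 = real L * PS" "1 \<in> {1..L}"
      using L by (auto simp: hop_power_def)
    show ?thesis
      unfolding power_constraints_def Se_def Sr_def
      using S_moments[OF encoder(2)] S_moments[OF relay(2)] encoder(1) relay(1) by simp
  qed
  moreover have "mean_square_stable M X"
    by (rule X_mean_square_stable[OF stable])
  ultimately show ?thesis
    unfolding linearly_stabilizable_def using alloc by blast
qed

section \<open>From the rate condition to contraction\<close>

lemma quality_eq:
  "quality L = real L * PS / (real L * PS + N 1) *
     (\<Prod>i=1..L-1. real L * P i / (real L * P i + N (i + 1)))"
proof -
  have "quality L = hop_power 1 / (hop_power 1 + N 1) * (\<Prod>i=Suc 1..L. hop_power i / (hop_power i + N i))"
    unfolding quality_def using L by (intro prod.atLeast_Suc_atMost) simp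
  also have "{Suc 1..L} = {Suc 1..Suc (L - 1)}"
    using L by simp
  finally show ?thesis
    unfolding prod.shift_bounds_cl_Suc_ivl by (simp add: hop_power_def)
qed

text \<open>Linear estimation multiplies the variance by \<open>1 - q \<le> 1 / (1 + q)\<close> in each round,
  where \<open>q = quality L\<close>, so the rate condition is more than sufficient.\<close>

lemma stable_if_rate:
  assumes "log 2 \<bar>lam\<bar> < cascade_rate L PS N P"
  shows "(lam\<^sup>2) ^ L * (1 - quality L) < 1"
proof -
  have "2 * real L * log 2 \<bar>lam\<bar> < log 2 (1 + quality L)"
    using assms L unfolding cascade_rate_def quality_eq[symmetric] by (simp add: field_simps)
  moreover have "2 * real L * log 2 \<bar>lam\<bar> = log 2 (\<bar>lam\<bar> ^ (2 * L))"
    using lam by (subst log_nat_power) auto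
  ultimately have "\<bar>lam\<bar> ^ (2 * L) < 1 + quality L"
    using lam quality_bounds by (simp add: log_less_cancel_iff)
  then have less: "(lam\<^sup>2) ^ L < 1 + quality L"
    by (simp add: power_mult)
  have "(lam\<^sup>2) ^ L * (1 - quality L) \<le> (1 + quality L) * (1 - quality L)"
    using less quality_bounds by (intro mult_right_mono) auto
  also have "\<dots> = 1 - (quality L)\<^sup>2"
    by (simp add: power2_eq_square algebra_simps)
  finally have "(lam\<^sup>2) ^ L * (1 - quality L) \<le> 1 - (quality L)\<^sup>2" .
  \<comment> \<open>Strictness comes from \<open>lam\<close>:
    \<open>1 \<le> (lam\<^sup>2) ^ L < 1 + quality L\<close>.\<close>
  moreover have "0 < quality L"
  proof -
    have "1 \<le> (lam\<^sup>2) ^ L" using lam by (simp add: abs_le_square_iff[of 1, simplified])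
    then show ?thesis using less by linarith
  qed
  ultimately show ?thesis
    using zero_less_power[of "quality L" 2] by linarith
qed

end

section \<open>Optimal power allocation\<close>

text \<open>The tangent at \<open>p\<close> lies above the graph of the concave function
  \<open>ln (l * x / (l * x + n))\<close>, whose derivative is \<open>n / (x * (l * x + n))\<close>.
  The proof applies \<open>ln r \<le> r - 1\<close> to the quotient \<open>r\<close> of the two
  arguments.\<close>

lemma ln_ratio_tangent:
  fixes l n p q :: real
  assumes "0 < l" "0 < n" "0 < p" "0 < q"
  shows "ln (l * q / (l * q + n)) \<le> ln (l * p / (l * p + n)) + n / (p * (l * p + n)) * (q - p)"
    and "q \<noteq> p \<Longrightarrow>
      ln (l * q / (l * q + n)) < ln (l * p / (l * p + n)) + n / (p * (l * p + n)) * (q - p)"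
proof -
  define r where "r = q * (l * p + n) / (p * (l * q + n))"
  have pos: "0 < l * p + n" "0 < l * q + n"
    using assms by (simp_all add: add_pos_pos)
  have "l * q / (l * q + n) = l * p / (l * p + n) * r"
    using assms pos by (simp add: r_def)
  moreover have r: "0 < r"
    using assms pos by (simp add: r_def)
  ultimately have "ln (l * q / (l * q + n)) = ln (l * p / (l * p + n)) + ln r"
    using assms pos r ln_mult[of "l * p / (l * p + n)" r] by simp
  moreover have "ln r \<le> r - 1"
    using r by (rule ln_le_minus_one)
  \<comment> \<open>\<open>r - 1\<close> is the linear term of the tangent minus a multiple of a
    square, which gives strictness for \<open>q \<noteq> p\<close>.\<close>
  moreover have "r - 1 = n / (p * (l * p + n)) * (q - p)
      - n * l * (q - p)\<^sup>2 / (p * (l * p + n) * (l * q + n))"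
  proof -
    have "r - 1 = n * (q - p) / (p * (l * q + n))"
    proof -
      have "r - 1 = (q * (l * p + n) - p * (l * q + n)) / (p * (l * q + n))"
        using assms pos by (simp add: r_def diff_divide_distrib)
      then show ?thesis by (simp add: algebra_simps)
    qed
    also have "\<dots> = (n * (q - p) * (l * q + n) - n * l * (q - p)\<^sup>2) / (p * (l * p + n) * (l * q + n))"
      using assms pos by (simp add: divide_simps) (simp add: power2_eq_square algebra_simps)
    also have "\<dots> = n / (p * (l * p + n)) * (q - p)
      - n * l * (q - p)\<^sup>2 / (p * (l * p + n) * (l * q + n))"
      using assms pos by (simp add: diff_divide_distrib)
    finally show ?thesis .
  qed
  moreover have "0 \<le> n * l * (q - p)\<^sup>2 / (p * (l * p + n) * (l * q + n))"
    using assms pos by simp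
  moreover have "0 < n * l * (q - p)\<^sup>2 / (p * (l * p + n) * (l * q + n))" if "q \<noteq> p"
    using assms pos that by simp
  ultimately show "ln (l * q / (l * q + n)) \<le> ln (l * p / (l * p + n)) + n / (p * (l * p + n)) * (q - p)"
    and "q \<noteq> p \<Longrightarrow>
      ln (l * q / (l * q + n)) < ln (l * p / (l * p + n)) + n / (p * (l * p + n)) * (q - p)"
    by linarith+
qed

text \<open>The Lagrange condition \<open>n i / (p i * (l * p i + n i)) = \<mu>\<close> is sufficient, since the
  logarithm of the product is concave.\<close>

lemma prod_ratio_maximum:
  fixes l \<mu> :: real and n p q :: "'i \<Rightarrow> real"
  assumes I: "finite I" and l: "0 < l" and \<mu>: "0 \<le> \<mu>"
    and n: "\<And>i. i \<in> I \<Longrightarrow> 0 < n i"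
    and p: "\<And>i. i \<in> I \<Longrightarrow> 0 < p i"
    and stationary: "\<And>i. i \<in> I \<Longrightarrow> n i / (p i * (l * p i + n i)) = \<mu>"
    and q: "\<And>i. i \<in> I \<Longrightarrow> 0 \<le> q i"
    and budget: "sum q I \<le> sum p I"
    and ne: "\<exists>i\<in>I. q i \<noteq> p i"
  shows "(\<Prod>i\<in>I. l * q i / (l * q i + n i)) < (\<Prod>i\<in>I. l * p i / (l * p i + n i))"
proof -
  have fac_pos: "0 < l * x i / (l * x i + n i)" if "i \<in> I" "0 < x i" for x i
    using l n that by (simp add: add_pos_pos)
  have p_prod: "0 < (\<Prod>i\<in>I. l * p i / (l * p i + n i))"
    using p fac_pos by (intro prod_pos) blast
  show ?thesis
  proof (cases "\<forall>i\<in>I. 0 < q i")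
    case True
    \<comment> \<open>All tangents have the same slope \<open>\<mu>\<close>, so their linear terms
      add up to \<open>\<mu> * (sum q I - sum p I)\<close>, which the budget makes
      nonpositive.\<close>
    have "(\<Sum>i\<in>I. ln (l * q i / (l * q i + n i))) < (\<Sum>i\<in>I. ln (l * p i / (l * p i + n i)) + \<mu> * (q i - p i))"
    proof (rule sum_strict_mono_ex1[OF I])
      show "\<forall>i\<in>I. ln (l * q i / (l * q i + n i)) \<le> ln (l * p i / (l * p i + n i)) + \<mu> * (q i - p i)"
        using ln_ratio_tangent(1)[OF l n p] True stationary by metis
      show "\<exists>i\<in>I. ln (l * q i / (l * q i + n i)) < ln (l * p i / (l * p i + n i)) + \<mu> * (q i - p i)"
        using ln_ratio_tangent(2)[OF l n p] True stationary ne by metis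
    qed
    also have "\<dots> = (\<Sum>i\<in>I. ln (l * p i / (l * p i + n i))) + \<mu> * (sum q I - sum p I)"
      by (simp add: sum.distrib sum_subtractf flip: sum_distrib_left)
    also have "\<dots> \<le> (\<Sum>i\<in>I. ln (l * p i / (l * p i + n i)))"
      using \<mu> budget by (simp add: mult_nonneg_nonpos)
    finally have sum_less:
      "(\<Sum>i\<in>I. ln (l * q i / (l * q i + n i))) < (\<Sum>i\<in>I. ln (l * p i / (l * p i + n i)))" .
    have "ln (\<Prod>i\<in>I. l * x i / (l * x i + n i)) = (\<Sum>i\<in>I. ln (l * x i / (l * x i + n i)))"
      if "\<And>i. i \<in> I \<Longrightarrow> 0 < x i" for x
      using fac_pos[of _ x] that by (intro ln_prod[OF I]) (metis less_irrefl)
    then have "ln (\<Prod>i\<in>I. l * q i / (l * q i + n i)) < ln (\<Prod>i\<in>I. l * p i / (l * p i + n i))"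
      using sum_less True p by simp
    moreover have "0 < (\<Prod>i\<in>I. l * q i / (l * q i + n i))"
      using True fac_pos by (intro prod_pos) blast
    ultimately show ?thesis using p_prod by simp
  next
    case False
    \<comment> \<open>One silent relay makes the whole product 0; logarithms are of no use
      here.\<close>
    then obtain i where "i \<in> I" "q i = 0"
      using q by force
    then have "(\<Prod>i\<in>I. l * q i / (l * q i + n i)) = 0"
      using I by auto
    then show ?thesis using p_prod by simp
  qed
qed

section \<open>Explicit relay powers and their optimality\<close>

lemma relay_power_Lagrange:
  assumes "0 < L" "0 < N (i + 1)" "\<gamma> < 0"
  shows "0 < relay_power L N \<gamma> i"
    and "N (i + 1) / (relay_power L N \<gamma> i * (real L * relay_power L N \<gamma> i + N (i + 1))) =
      - \<gamma> * real L"
proof -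
  define n where "n = N (i + 1)"
  define d where "d = sqrt (n\<^sup>2 - 4 * n / \<gamma>)"
  \<comment> \<open>The transmit power, the positive root of
    \<open>q * (q + n) = - n / \<gamma>\<close>; inserting this product yields the common multiplier
    \<open>- \<gamma> * real L\<close>.\<close>
  define q where "q = (- n + d) / 2"
  have n: "0 < n" using assms by (simp add: n_def)
  have g: "0 < - 4 * n / \<gamma>" using n assms(3) by (intro divide_neg_neg) auto
  have "n < d"
    unfolding d_def using n g by (intro real_less_rsqrt) simp
  then have q: "0 < q" by (simp add: q_def)
  have "d\<^sup>2 = n\<^sup>2 - 4 * n / \<gamma>"
    using g unfolding d_def by (intro real_sqrt_pow2) (simp add: add_nonneg_nonneg diff_conv_add_uminus del: add_uminus_conv_diff)
  then have qq: "q * (q + n) = - n / \<gamma>"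
    by (simp add: q_def power2_eq_square field_simps)
  have rp: "relay_power L N \<gamma> i = q / real L"
    by (simp add: relay_power_def q_def d_def n_def)
  show "0 < relay_power L N \<gamma> i"
    using q assms by (simp add: rp)
  have "n / (q / real L * (real L * (q / real L) + n)) = n * real L / (q * (q + n))"
    using assms(1) by simp
  also have "\<dots> = - \<gamma> * real L"
    unfolding qq using n assms by (simp add: field_simps)
  finally show "N (i + 1) / (relay_power L N \<gamma> i * (real L * relay_power L N \<gamma> i + N (i + 1))) =
      - \<gamma> * real L"
    by (simp add: rp n_def)
qed

lemma ex_relay_power_sum:
  assumes L: "2 \<le> L" and N: "\<forall>i\<in>{1..L}. 0 < N i" and PR: "0 < PR"
  shows "\<exists>\<gamma><0. (\<Sum>i=1..L-1. relay_power L N \<gamma> i) = PR"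
proof -
  \<comment> \<open>The total relay power as a function of \<open>s = - 1 / \<gamma>\<close>, which
    extends continuously to \<open>s = 0\<close>.\<close>
  define F where "F s = (\<Sum>i=1..L-1. ((- N (i + 1) + sqrt ((N (i + 1))\<^sup>2 + 4 * N (i + 1) * s)) / 2) / real L)"
    for s :: real
  define q where "q = real L * PR"
  \<comment> \<open>Chosen so that relay 1 alone uses the whole budget:
    \<open>q = real L * PR\<close> solves \<open>q * (q + N 2) = N 2 * s1\<close>.\<close>
  define s1 where "s1 = q * (q + N 2) / N 2"
  have N': "0 < N (i + 1)" if "i \<in> {1..L-1}" for i
    using N that by auto
  have N2: "0 < N 2" using N L by auto
  have q: "0 < q" using L PR by (simp add: q_def)
  have s1: "0 \<le> s1" using q N2 by (simp add: s1_def)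
  have F0: "F 0 = 0"
    unfolding F_def by (intro sum.neutral ballI) (use N' in \<open>simp add: less_imp_le\<close>)
  have "4 * N 2 * s1 = 4 * (q * (q + N 2))"
    using N2 by (simp add: s1_def)
  then have "(N 2)\<^sup>2 + 4 * N 2 * s1 = (N 2 + 2 * q)\<^sup>2"
    by (simp add: power2_eq_square algebra_simps)
  then have "sqrt ((N 2)\<^sup>2 + 4 * N 2 * s1) = N 2 + 2 * q"
    using N2 q by simp
  then have "PR = ((- N (1 + 1) + sqrt ((N (1 + 1))\<^sup>2 + 4 * N (1 + 1) * s1)) / 2) / real L"
    using L by (simp add: q_def numeral_2_eq_2)
  also have "\<dots> \<le> F s1"
    unfolding F_def
  proof (rule member_le_sum)
    show "1 \<in> {1..L-1}" using L by auto
    fix i assume "i \<in> {1..L-1} - {1}"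
    then have i: "0 < N (i + 1)" using N' by blast
    have "N (i + 1) \<le> sqrt ((N (i + 1))\<^sup>2 + 4 * N (i + 1) * s1)"
      using i s1 by (intro real_le_rsqrt) simp
    then show "0 \<le> ((- N (i + 1) + sqrt ((N (i + 1))\<^sup>2 + 4 * N (i + 1) * s1)) / 2) / real L"
      by simp
  qed simp
  finally have F1: "PR \<le> F s1" .
  have "continuous_on {0..s1} F"
    unfolding F_def using L by (intro continuous_intros) auto
  then obtain s where s: "0 \<le> s" "F s = PR"
    using IVT'[of F 0 PR s1] F0 F1 PR s1 by auto
  then have "0 < s" using F0 PR by (cases "s = 0") auto
  have "(\<Sum>i=1..L-1. relay_power L N (- (1 / s)) i) = F s"
    unfolding F_def relay_power_def using \<open>0 < s\<close> by (intro sum.cong) auto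
  then show ?thesis
    using s \<open>0 < s\<close> by (intro exI[of _ "- (1 / s)"]) auto
qed

lemma cascade_rate_mono_iff:
  assumes L: "2 \<le> L" and PS: "0 < PS" and N: "\<forall>i\<in>{1..L}. 0 < N i"
    and P: "P \<in> relay_allocations L PR" and Q: "Q \<in> relay_allocations L PR"
  shows "cascade_rate L PS N Q < cascade_rate L PS N P \<longleftrightarrow>
    (\<Prod>i=1..L-1. real L * Q i / (real L * Q i + N (i + 1))) <
    (\<Prod>i=1..L-1. real L * P i / (real L * P i + N (i + 1)))"
proof -
  define c where "c = real L * PS / (real L * PS + N 1)"
  have "0 < N 1" using N L by auto
  then have c: "0 < c" using PS L by (simp add: c_def add_pos_pos)
  have prod_nonneg: "0 \<le> (\<Prod>i=1..L-1. real L * x i / (real L * x i + N (i + 1)))"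
    if "x \<in> relay_allocations L PR" for x
  proof (rule prod_nonneg)
    fix i assume i: "i \<in> {1..L-1}"
    then have "0 < N (i + 1)" "0 \<le> x i"
      using N that by (auto simp: relay_allocations_def)
    then show "0 \<le> real L * x i / (real L * x i + N (i + 1))"
      by simp
  qed
  have pos: "0 < 1 + c * (\<Prod>i=1..L-1. real L * x i / (real L * x i + N (i + 1)))"
    if "x \<in> relay_allocations L PR" for x
    using c prod_nonneg[OF that] by (simp add: add_pos_nonneg)
  show ?thesis
    unfolding cascade_rate_def c_def[symmetric]
    using L c pos[OF P] pos[OF Q]
    by (simp add: divide_less_cancel)
qed

text \<open>By strict concavity every feasible allocation that differs at some relay is strictly
  worse. Entries outside \<open>{1..L-1}\<close> do not enter the rate, so uniqueness is meant on
  that range.\<close>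

lemma optimal_allocation_iff:
  assumes L: "2 \<le> L" and PS: "0 < PS" and N: "\<forall>i\<in>{1..L}. 0 < N i"
    and \<gamma>: "\<gamma> < 0" and total: "(\<Sum>i=1..L-1. relay_power L N \<gamma> i) = PR"
  shows "optimal_allocation L PS PR N P \<longleftrightarrow> (\<forall>i\<in>{1..L-1}. P i = relay_power L N \<gamma> i)"
proof -
  let ?p = "relay_power L N \<gamma>"
  have N': "0 < N (i + 1)" if "i \<in> {1..L-1}" for i
    using N that by auto
  have p: "0 < ?p i" if "i \<in> {1..L-1}" for i
    using relay_power_Lagrange(1)[of L N i] L N'[OF that] \<gamma> by simp
  have p_alloc: "?p \<in> relay_allocations L PR"
    using p total by (auto simp: relay_allocations_def less_imp_le)
  have less: "cascade_rate L PS N Q < cascade_rate L PS N ?p"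
    if Q: "Q \<in> relay_allocations L PR" and ne: "\<exists>i\<in>{1..L-1}. Q i \<noteq> ?p i" for Q
    unfolding cascade_rate_mono_iff[OF L PS N p_alloc Q]
  proof (rule prod_ratio_maximum[OF _ _ _ _ _ _ _ _ ne])
    show "N (i + 1) / (?p i * (real L * ?p i + N (i + 1))) = - \<gamma> * real L" if "i \<in> {1..L-1}" for i
      using relay_power_Lagrange(2)[of L N i] L N'[OF that] \<gamma> by simp
  qed (use L N' p Q total \<gamma> in \<open>auto simp: relay_allocations_def mult_nonpos_nonneg\<close>)
  show ?thesis
  proof
    assume opt: "optimal_allocation L PS PR N P"
    then have "P \<in> relay_allocations L PR" "\<not> cascade_rate L PS N P < cascade_rate L PS N ?p"
      using p_alloc by (auto simp: optimal_allocation_def is_arg_max_def)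
    then show "\<forall>i\<in>{1..L-1}. P i = ?p i"
      using less by blast
  next
    assume eq: "\<forall>i\<in>{1..L-1}. P i = ?p i"
    then have rate: "cascade_rate L PS N P = cascade_rate L PS N ?p"
      by (simp add: cascade_rate_def)
    have "P \<in> relay_allocations L PR"
      using p_alloc eq by (simp add: relay_allocations_def)
    moreover have "\<not> cascade_rate L PS N P < cascade_rate L PS N Q"
      if "Q \<in> relay_allocations L PR" for Q
    proof (cases "\<exists>i\<in>{1..L-1}. Q i \<noteq> ?p i")
      case True
      then show ?thesis using less[OF that] rate by simp
    next
      case False
      then have "cascade_rate L PS N Q = cascade_rate L PS N ?p"
        by (simp add: cascade_rate_def)
      then show ?thesis using rate by simp
    qed
    ultimately show "optimal_allocation L PS PR N P"
      by (auto simp: optimal_allocation_def is_arg_max_def)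
  qed
qed

text \<open>\<open>relay_power\<close> depends on \<open>i\<close> only through
  \<open>N (i + 1)\<close>, so the budget is split evenly.\<close>

lemma relay_power_equal_noise:
  assumes L: "2 \<le> L" and eq: "\<forall>i\<in>{1..L}. \<forall>j\<in>{1..L}. N i = N j"
    and total: "(\<Sum>i=1..L-1. relay_power L N \<gamma> i) = PR" and i: "i \<in> {1..L-1}"
  shows "relay_power L N \<gamma> i = PR / (real L - 1)"
proof -
  have "relay_power L N \<gamma> j = relay_power L N \<gamma> i" if "j \<in> {1..L-1}" for j
  proof -
    have "N (j + 1) = N (i + 1)" using eq i that by auto
    then show ?thesis by (simp add: relay_power_def)
  qed
  then have "(\<Sum>j=1..L-1. relay_power L N \<gamma> j) = real (L - 1) * relay_power L N \<gamma> i"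
    by simp
  then show ?thesis
    using total L by (simp add: of_nat_diff field_simps)
qed

theorem theorem3p2:
  fixes M :: "'a measure"
    and L :: nat
    and lam B PS PR vW :: real
    and N :: "nat \<Rightarrow> real"
    and X0 :: "'a \<Rightarrow> real"
    and W :: "nat \<Rightarrow> 'a \<Rightarrow> real"
    and Z :: "nat \<Rightarrow> nat \<Rightarrow> 'a \<Rightarrow> real"
  assumes "prob_space M"
    and "2 \<le> L"
    and "1 \<le> \<bar>lam\<bar>"
    and "B \<noteq> 0"
    and "0 < PS"
    and "0 < PR"
    and "0 < vW"
    and "\<forall>i\<in>{1..L}. 0 < N i"
    and "cascade_sources M L vW N X0 W Z"
  shows "(log 2 \<bar>lam\<bar> < (SUP P\<in>relay_allocations L PR. cascade_rate L PS N P) \<longrightarrow>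
            linearly_stabilizable M L lam B PS PR X0 W Z) \<and>
         (\<exists>\<gamma><0. (\<Sum>i=1..L-1. relay_power L N \<gamma> i) = PR) \<and>
         (\<forall>\<gamma><0. (\<Sum>i=1..L-1. relay_power L N \<gamma> i) = PR \<longrightarrow>
            (\<forall>P. optimal_allocation L PS PR N P \<longleftrightarrow> (\<forall>i\<in>{1..L-1}. P i = relay_power L N \<gamma> i))) \<and>
         ((\<forall>i\<in>{1..L}. \<forall>j\<in>{1..L}. N i = N j) \<longrightarrow>
            (\<forall>P. optimal_allocation L PS PR N P \<longleftrightarrow> (\<forall>i\<in>{1..L-1}. P i = PR / (real L - 1))))"
proof -
  interpret prob_space M by fact
  have alloc_ne: "relay_allocations L PR \<noteq> {}"
    using assms by (auto simp: relay_allocations_def intro!: exI[of _ "\<lambda>_. 0"])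
  have stabilizable: "linearly_stabilizable M L lam B PS PR X0 W Z"
    if rate: "log 2 \<bar>lam\<bar> < (SUP P\<in>relay_allocations L PR. cascade_rate L PS N P)"
  proof -
    \<comment> \<open>If no allocation exceeded \<open>log 2 \<bar>lam\<bar>\<close>, neither would
      the supremum over this nonempty set.\<close>
    obtain P where best: "P \<in> relay_allocations L PR" "log 2 \<bar>lam\<bar> < cascade_rate L PS N P"
      using cSUP_least[OF alloc_ne] rate by (meson not_le)
    interpret cascade M L lam B PS vW N P X0 W Z
      using assms best by unfold_locales (auto simp: relay_allocations_def)
    show ?thesis
      using linearly_stabilizable_if stable_if_rate best by blast
  qed
  obtain \<gamma> where \<gamma>: "\<gamma> < 0" "(\<Sum>i=1..L-1. relay_power L N \<gamma> i) = PR"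
    using ex_relay_power_sum assms by blast
  have optimal: "optimal_allocation L PS PR N P \<longleftrightarrow> (\<forall>i\<in>{1..L-1}. P i = relay_power L N \<gamma> i)"
    if "\<gamma> < 0" "(\<Sum>i=1..L-1. relay_power L N \<gamma> i) = PR" for \<gamma> P
    using optimal_allocation_iff assms that by blast
  have "optimal_allocation L PS PR N P \<longleftrightarrow> (\<forall>i\<in>{1..L-1}. P i = PR / (real L - 1))"
    if "\<forall>i\<in>{1..L}. \<forall>j\<in>{1..L}. N i = N j" for P
    unfolding optimal[OF \<gamma>] using relay_power_equal_noise[OF assms(2) that \<gamma>(2)] by simp
  then show ?thesis
    using stabilizable \<gamma> optimal by blast
qed

end
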